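(* In the fully-online setting, no deterministic algorithm for non-preemptive makespan minimization on two identical machines with testing is $c$-competitive for any $c<2.0953$.
   Context: Scheduling with testing on identical parallel machines: each job $j$ has a testing time $t_j\ge 0$, an upper bound $u_j\ge 0$ and a processing time $p_j$ with $0\le p_j\le u_j$. A job can either be run untested, occupying a machine for time $u_j$, or be tested and then executed, occupying a machine for total time $t_j+p_j$; the value $p_j$ is revealed to the algorithm only when the test of $j$ is completed. Fully-online setting: jobs arrive one by one; when job $j$ arrives its $t_j$ and $u_j$ are revealed, and the algorithm must irrevocably decide whether to test it and to which machine to assign it before the next job arrives. Non-preemptive: each job runs without interruption on its assigned machine. The objective is the makespan. $\mathrm{OPT}$ denotes the minimum makespan achievable by an offline scheduler knowing the whole instance including all $p_j$ (job $j$ needs time $\min(t_j+p_j,u_j)$ in the optimum). A deterministic algorithm is $c$-competitive if $\mathrm{ALG}\le c\cdot\mathrm{OPT}$ on every instance. *)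

theory Defs
  imports Complex_Main
begin

record job =
  test_time :: real
  upper_bound :: real
  proc_time :: real

definition valid_job :: "job \<Rightarrow> bool" where
  "valid_job j \<longleftrightarrow>
     0 \<le> test_time j \<and> 0 \<le> proc_time j \<and> proc_time j \<le> upper_bound j"

text \<open>A decision is a pair \<open>(tested, machine)\<close>; the machines are \<open>0, \<dots>, m - 1\<close>.\<close>

type_synonym decision = "bool \<times> nat"

definition occupied_time :: "job \<Rightarrow> bool \<Rightarrow> real" where
  "occupied_time j tested = (if tested then test_time j + proc_time j else upper_bound j)"

definition load :: "job list \<Rightarrow> decision list \<Rightarrow> nat \<Rightarrow> real" where
  "load js ds i =
     (\<Sum>k | k < length js \<and> snd (ds ! k) = i. occupied_time (js ! k) (fst (ds ! k)))"

text \<open>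
  All jobs are available from time \<open>0\<close>, so a machine completes the jobs assigned to it
  exactly at its load when it runs them back to back, and never earlier; see
  \<open>makespan_le_schedule\<close> and \<open>makespan_attained\<close> below.
\<close>

definition makespan :: "nat \<Rightarrow> job list \<Rightarrow> decision list \<Rightarrow> real" where
  "makespan m js ds = Max (load js ds ` {..<m})"

definition decisions :: "nat \<Rightarrow> job list \<Rightarrow> decision list set" where
  "decisions m js = {ds. length ds = length js \<and> (\<forall>d\<in>set ds. snd d < m)}"

definition opt :: "nat \<Rightarrow> job list \<Rightarrow> real" where
  "opt m js = Min (makespan m js ` decisions m js)"

text \<open>
  What the algorithm knows about an earlier job: testing time, upper bound, its own decision,
  and the processing time if and only if the job was tested.
\<close>

type_synonym observation = "real \<times> real \<times> decision \<times> real option"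

definition observe :: "job \<Rightarrow> decision \<Rightarrow> observation" where
  "observe j d =
     (test_time j, upper_bound j, d, if fst d then Some (proc_time j) else None)"

text \<open>
  A deterministic fully-online algorithm maps the observations of the earlier jobs (in order of
  arrival) and the testing time and upper bound of the arriving job to its decision on that job.
\<close>

type_synonym online_algorithm = "observation list \<Rightarrow> real \<Rightarrow> real \<Rightarrow> decision"

definition uses_machines :: "nat \<Rightarrow> online_algorithm \<Rightarrow> bool" where
  "uses_machines m A \<longleftrightarrow> (\<forall>h t u. snd (A h t u) < m)"

fun run_from :: "online_algorithm \<Rightarrow> observation list \<Rightarrow> job list \<Rightarrow> decision list" where
  "run_from A h [] = []"
| "run_from A h (j # js) =
     (let d = A h (test_time j) (upper_bound j)
      in d # run_from A (h @ [observe j d]) js)"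

definition alg_makespan :: "nat \<Rightarrow> online_algorithm \<Rightarrow> job list \<Rightarrow> real" where
  "alg_makespan m A js = makespan m js (run_from A [] js)"

definition competitive :: "nat \<Rightarrow> online_algorithm \<Rightarrow> real \<Rightarrow> bool" where
  "competitive m A c \<longleftrightarrow>
     (\<forall>js. (\<forall>j\<in>set js. valid_job j) \<longrightarrow> alg_makespan m A js \<le> c * opt m js)"


subsection \<open>Makespan and non-preemptive schedules with start times\<close>

text \<open>\<open>s k\<close> is the start time of the \<open>k\<close>-th job, and \<open>C\<close> a time by which all jobs are completed.\<close>

definition schedule :: "job list \<Rightarrow> decision list \<Rightarrow> (nat \<Rightarrow> real) \<Rightarrow> real \<Rightarrow> bool" where
  "schedule js ds s C \<longleftrightarrow>
     0 \<le> C \<and>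
     (\<forall>k<length js. 0 \<le> s k \<and> s k + occupied_time (js ! k) (fst (ds ! k)) \<le> C) \<and>
     (\<forall>k<length js. \<forall>l<length js. k \<noteq> l \<and> snd (ds ! k) = snd (ds ! l) \<longrightarrow>
        s k + occupied_time (js ! k) (fst (ds ! k)) \<le> s l \<or>
        s l + occupied_time (js ! l) (fst (ds ! l)) \<le> s k)"

lemma sum_lengths_le:
  fixes s d :: "nat \<Rightarrow> real"
  assumes "finite I" "0 \<le> C" "\<And>k. k \<in> I \<Longrightarrow> 0 \<le> s k \<and> 0 \<le> d k \<and> s k + d k \<le> C"
    and "\<And>k l. k \<in> I \<Longrightarrow> l \<in> I \<Longrightarrow> k \<noteq> l \<Longrightarrow> s k + d k \<le> s l \<or> s l + d l \<le> s k"
  shows "sum d I \<le> C"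
  using assms
proof (induction "card I" arbitrary: I C)
  case 0
  then show ?case by simp
next
  case (Suc n)
  then have "I \<noteq> {}" by auto
  have "Max (s ` I) \<in> s ` I" using Suc.prems(1) \<open>I \<noteq> {}\<close> by simp
  then obtain i where i: "i \<in> I" "s i = Max (s ` I)" by auto
  have mx: "s k \<le> s i" if "k \<in> I" for k
    using that i Suc.prems(1) by simp
  have n: "n = card (I - {i})" using Suc.hyps(2) i Suc.prems(1) by simp
  have split: "sum d I = d i + sum d (I - {i})"
    using i Suc.prems(1) by (simp add: sum.remove)
  have ord: "s k + d k \<le> s l \<or> s l + d l \<le> s k"
    if "k \<in> I - {i}" "l \<in> I - {i}" "k \<noteq> l" for k l
    using Suc.prems(4)[of k l] that by auto
  show ?case
  proof (cases "d i = 0")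
    case True
    have "sum d (I - {i}) \<le> C"
      by (rule Suc.hyps(1)[OF n _ Suc.prems(2)]) (use Suc.prems ord in auto)
    then show ?thesis using split True by simp
  next
    case False
    have "0 \<le> s k \<and> 0 \<le> d k \<and> s k + d k \<le> s i" if "k \<in> I - {i}" for k
      using Suc.prems(3)[of k] Suc.prems(3)[of i] Suc.prems(4)[of k i] mx[of k] that i False
      by force
    then have "sum d (I - {i}) \<le> s i"
      by (intro Suc.hyps(1)[OF n]) (use Suc.prems(1) Suc.prems(3)[OF i(1)] ord in auto)
    then show ?thesis using split Suc.prems(3)[of i] i by simp
  qed
qed

lemma occupied_time_nonneg: "valid_job j \<Longrightarrow> 0 \<le> occupied_time j b"
  by (auto simp: valid_job_def occupied_time_def)

lemma makespan_le_schedule: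
  assumes "0 < m" "\<forall>j\<in>set js. valid_job j" "schedule js ds s C"
  shows "makespan m js ds \<le> C"
proof -
  have "load js ds i \<le> C" for i
    unfolding load_def
    by (rule sum_lengths_le[where s = s])
      (use assms(2,3) in \<open>auto simp: schedule_def occupied_time_nonneg\<close>)
  moreover have "load js ds ` {..<m} \<noteq> {}" using assms(1) by auto
  ultimately show ?thesis unfolding makespan_def by (subst Max_le_iff) auto
qed

lemma makespan_attained:
  assumes "0 < m" "\<forall>j\<in>set js. valid_job j" "ds \<in> decisions m js"
  shows "\<exists>s. schedule js ds s (makespan m js ds)"
proof -
  define d where "d k = occupied_time (js ! k) (fst (ds ! k))" for k
  define s where "s k = (\<Sum>l | l < k \<and> snd (ds ! l) = snd (ds ! k). d l)" for k
  have d0: "0 \<le> d k" if "k < length js" for k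
    using that assms(2) by (simp add: d_def occupied_time_nonneg)
  have step: "s k + d k = (\<Sum>l | l \<le> k \<and> snd (ds ! l) = snd (ds ! k). d l)" for k
  proof -
    have "{l. l \<le> k \<and> snd (ds ! l) = snd (ds ! k)}
        = insert k {l. l < k \<and> snd (ds ! l) = snd (ds ! k)}" by auto
    then show ?thesis by (simp add: s_def)
  qed
  have seq: "s k + d k \<le> s l"
    if "k < l" "l < length js" "snd (ds ! k) = snd (ds ! l)" for k l
    unfolding step unfolding s_def
    by (rule sum_mono2) (use that d0 in auto)
  have load_le: "load js ds i \<le> makespan m js ds" if "i < m" for i
    unfolding makespan_def using that by simp
  have "s k + d k \<le> makespan m js ds" if k: "k < length js" for k
  proof -
    have "s k + d k \<le> load js ds (snd (ds ! k))"
      unfolding step load_def d_def[symmetric]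
      by (rule sum_mono2) (use k d0 in auto)
    also have "\<dots> \<le> makespan m js ds"
      using assms(3) k by (intro load_le) (auto simp: decisions_def)
    finally show ?thesis .
  qed
  moreover have "0 \<le> s k" if "k < length js" for k
    unfolding s_def by (rule sum_nonneg) (use that d0 in auto)
  moreover have "0 \<le> makespan m js ds"
  proof -
    have "0 \<le> load js ds 0"
      unfolding load_def d_def[symmetric] by (rule sum_nonneg) (use d0 in auto)
    then show ?thesis using load_le[of 0] assms(1) by simp
  qed
  moreover have "s k + d k \<le> s l \<or> s l + d l \<le> s k"
    if "k < length js" "l < length js" "k \<noteq> l" "snd (ds ! k) = snd (ds ! l)" for k l
    using seq[of k l] seq[of l k] that by (cases "k < l") auto
  ultimately show ?thesis unfolding schedule_def d_def by blast
qed

end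

theory Submission imports Defs begin

text \<open>
  The adversary fixes the processing time after the decision on the job: \<open>u\<close> if the job was
  tested, \<open>0\<close> otherwise, so that the optimum always takes the opposite testing decision.
  It first releases two jobs with \<open>t = 2\<close> and \<open>u = 4\<close>. If they share a machine, the ratio is at
  least \<open>10 / 4\<close>. Otherwise it releases a last job with \<open>(t, u)\<close> equal to \<open>(3, 6)\<close>, \<open>(6, 9)\<close> or
  \<open>(7, 11)\<close> when the algorithm has tested none, one or two of the first two jobs; the optimum puts
  this job on a machine of its own, and the smallest ratio that arises is
  \<open>(4 + 15) / 9 = 19 / 9 > 2.1\<close>.
\<close>

lemma load_Nil [simp]: "load [] ds i = 0"
  by (simp add: load_def)

text \<open>Peeling off index 0 lets the simplifier evaluate loads of explicit job lists, so the
  adversary's cases end in plain arithmetic.\<close>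

lemma load_Cons [simp]:
  "load (j # js) (d # ds) i = (if snd d = i then occupied_time j (fst d) else 0) + load js ds i"
proof -
  have "load (j # js) (d # ds) i
      = (\<Sum>k<Suc (length js). if snd ((d # ds) ! k) = i
           then occupied_time ((j # js) ! k) (fst ((d # ds) ! k)) else 0)"
    unfolding load_def by (simp add: sum.inter_filter[symmetric] lessThan_def)
  also have "\<dots> = (if snd d = i then occupied_time j (fst d) else 0)
      + (\<Sum>k<length js. if snd (ds ! k) = i then occupied_time (js ! k) (fst (ds ! k)) else 0)"
    by (subst sum.lessThan_Suc_shift) (simp cong: if_cong)
  also have "(\<Sum>k<length js. if snd (ds ! k) = i
      then occupied_time (js ! k) (fst (ds ! k)) else 0) = load js ds i"
    unfolding load_def by (simp add: sum.inter_filter[symmetric] lessThan_def)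
  finally show ?thesis .
qed

lemma load_nonneg: "\<forall>j\<in>set js. valid_job j \<Longrightarrow> 0 \<le> load js ds i"
  unfolding load_def by (rule sum_nonneg) (simp add: occupied_time_nonneg)

lemma load_le_makespan: "i < m \<Longrightarrow> load js ds i \<le> makespan m js ds"
  unfolding makespan_def by simp

lemma makespan_two: "makespan 2 js ds = max (load js ds 0) (load js ds 1)"
proof -
  have "{..<2::nat} = {0, 1}" by auto
  then show ?thesis by (simp add: makespan_def)
qed

lemma finite_decisions: "finite (decisions m js)"
proof -
  have "decisions m js \<subseteq> {ds. set ds \<subseteq> UNIV \<times> {..<m} \<and> length ds = length js}"
    by (auto simp: decisions_def)
  then show ?thesis
    by (rule finite_subset) (simp add: finite_lists_length_eq)
qed

lemma opt_le_makespan: "ds \<in> decisions m js \<Longrightarrow> opt m js \<le> makespan m js ds"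
  unfolding opt_def by (simp add: finite_decisions)

lemma opt_nonneg:
  assumes "0 < m" "\<forall>j\<in>set js. valid_job j"
  shows "0 \<le> opt m js"
proof -
  have "replicate (length js) (True, 0) \<in> decisions m js"
    using assms(1) by (auto simp: decisions_def)
  moreover have "0 \<le> makespan m js ds" for ds
    using load_nonneg[OF assms(2)] load_le_makespan[OF assms(1)] by (rule order_trans)
  ultimately show ?thesis
    unfolding opt_def by (subst Min_ge_iff) (auto simp: finite_decisions)
qed

text \<open>Since \<open>opt\<close> is nonnegative, a larger factor only weakens the bound;
  refuting the single factor \<open>21 / 10\<close> thus settles every smaller one.\<close>

lemma competitive_mono:
  assumes "0 < m" "competitive m A c" "c \<le> c'"
  shows "competitive m A c'"
  unfolding competitive_def
proof (intro allI impI)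
  fix js assume js: "\<forall>j\<in>set js. valid_job j"
  then have "alg_makespan m A js \<le> c * opt m js"
    using assms(2) by (simp add: competitive_def)
  also have "\<dots> \<le> c' * opt m js"
    using assms(3) opt_nonneg[OF assms(1) js] by (rule mult_right_mono)
  finally show "alg_makespan m A js \<le> c' * opt m js" .
qed

text \<open>One machine bounds the algorithm's makespan from below and one offline solution
  \<open>ds\<close> bounds \<open>opt\<close> from above, so \<open>opt\<close> never has to be
  computed exactly.\<close>

lemma competitive_load_le:
  assumes "competitive m A c" "0 \<le> c" "\<forall>j\<in>set js. valid_job j" "i < m" "ds \<in> decisions m js"
  shows "load js (run_from A [] js) i \<le> c * makespan m js ds"
proof -
  have "load js (run_from A [] js) i \<le> alg_makespan m A js"
    unfolding alg_makespan_def using assms(4) by (rule load_le_makespan)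
  also have "\<dots> \<le> c * opt m js"
    using assms(1,3) by (simp add: competitive_def)
  also have "\<dots> \<le> c * makespan m js ds"
    using opt_le_makespan[OF assms(5)] assms(2) by (rule mult_left_mono)
  finally show ?thesis .
qed

definition adversarial_job :: "real \<Rightarrow> real \<Rightarrow> bool \<Rightarrow> job" where
  "adversarial_job t u tested =
     \<lparr>test_time = t, upper_bound = u, proc_time = (if tested then u else 0)\<rparr>"

lemma adversarial_job_simps [simp]:
  "test_time (adversarial_job t u b) = t"
  "upper_bound (adversarial_job t u b) = u"
  "occupied_time (adversarial_job t u b) b' = (if b' then if b then t + u else t else u)"
  "valid_job (adversarial_job t u b) \<longleftrightarrow> 0 \<le> t \<and> 0 \<le> u"
  by (auto simp: adversarial_job_def occupied_time_def valid_job_def)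

lemma not_competitive_two_machines:
  assumes "uses_machines 2 A"
  shows "\<not> competitive 2 A (21 / 10)"
proof
  assume comp: "competitive 2 A (21 / 10)"
  note bound = competitive_load_le[OF comp, simplified]
  have machine: "snd (A h t u) = 0 \<or> snd (A h t u) = 1" for h t u
    using assms by (auto simp: uses_machines_def less_2_cases_iff)
  define d1 where "d1 = A [] 2 4"
  \<comment> \<open>Not circular: \<open>A\<close> fixes \<open>d1\<close> from the testing time and
    upper bound alone.\<close>
  define j1 where "j1 = adversarial_job 2 4 (fst d1)"
  define d2 where "d2 = A [observe j1 d1] 2 4"
  define j2 where "j2 = adversarial_job 2 4 (fst d2)"
  \<comment> \<open>Let L be 4, 6 or 8, the offline total of the first two jobs when none, one or
    both were tested. Always \<open>t\<close> \<le> L \<le> \<open>u\<close>, so the offline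
    makespan is L if the last job is not tested by \<open>A\<close>, and \<open>u\<close> if it
    is.\<close>
  define t :: real where
    "t = (if fst d1 \<and> fst d2 then 7 else if fst d1 \<or> fst d2 then 6 else 3)"
  define u :: real where
    "u = (if fst d1 \<and> fst d2 then 11 else if fst d1 \<or> fst d2 then 9 else 6)"
  define d3 where "d3 = A [observe j1 d1, observe j2 d2] t u"
  define j3 where "j3 = adversarial_job t u (fst d3)"
  have run2: "run_from A [] [j1, j2] = [d1, d2]"
    by (simp add: Let_def d1_def j1_def d2_def j2_def)
  have run3: "run_from A [] [j1, j2, j3] = [d1, d2, d3]"
    by (simp add: Let_def d1_def j1_def d2_def j2_def d3_def j3_def)
  have valid: "valid_job j1" "valid_job j2" "valid_job j3"
    by (simp_all add: j1_def j2_def j3_def t_def u_def)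
  have m: "snd d1 = 0 \<or> snd d1 = 1" "snd d2 = 0 \<or> snd d2 = 1" "snd d3 = 0 \<or> snd d3 = 1"
    unfolding d1_def d2_def d3_def by (rule machine)+
  have two: "load [j1, j2] [d1, d2] i
      \<le> 21 / 10 * makespan 2 [j1, j2] [(\<not> fst d1, 0), (\<not> fst d2, 1)]" if "i < 2" for i
    using bound[of "[j1, j2]" i] that valid run2 by (simp add: decisions_def)
  have three: "load [j1, j2, j3] [d1, d2, d3] i
      \<le> 21 / 10 * makespan 2 [j1, j2, j3] [(\<not> fst d1, 0), (\<not> fst d2, 0), (\<not> fst d3, 1)]"
    if "i < 2" for i
    using bound[of "[j1, j2, j3]" i] that valid run3 by (simp add: decisions_def)
  show False
  proof (cases "snd d1 = snd d2")
    case True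
    then show ?thesis
      using two[of "snd d1"] m(1)
      by (cases "fst d1"; cases "fst d2") (auto simp: makespan_two j1_def j2_def)
  next
    case False
    then show ?thesis
      \<comment> \<open>Both machines are already busy, so the machine of the last job also carries
        one of the first two, of length at least 4, or 6 if both were tested.\<close>
      using three[of "snd d3"] m
      by (cases "fst d1"; cases "fst d2"; cases "fst d3")
        (auto simp: makespan_two j1_def j2_def j3_def t_def u_def)
  qed
qed

theorem theorem8:
  fixes c :: real
  assumes "c < 2.0953"
  shows "\<not> (\<exists>A :: online_algorithm. uses_machines 2 A \<and> competitive 2 A c)"
proof -
  have "c \<le> 21 / 10" using assms by simp
  then show ?thesis
    using not_competitive_two_machines competitive_mono[of 2 _ c "21 / 10"] by auto
qed

end
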